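(* Let $m\ge 2$ be an integer, let $\Gamma,\lambda,\beta_1,\dots,\beta_m\in\mathbb{R}$ with $\Gamma\neq 0$, and define $$Q:=y+\Gamma x^2,\qquad f_1=x+\sum_{i=1}^{m}\beta_i\,Q^{i},\qquad f_2=Q+\lambda f_1,\qquad f=(f_1,f_2).$$ Then $\det Df\equiv 1$. Consequently, $\mathcal{H}=\tfrac12(f_1^2+f_2^2)$ is a trivial isochronous Hamiltonian with $\deg f=2m$ and system degree $$n=2\deg f-1=4m-1\equiv 3\pmod 4.$$
   Context: The planar polynomial Hamiltonian system generated by $\mathcal{H}\in\mathbb{R}[x,y]$ (with $\mathcal{H}(0,0)=0$) is $\dot x=-\mathcal{H}_y(x,y)$, $\dot y=\mathcal{H}_x(x,y)$. Its degree $n$ (the system degree) is the maximum of the degrees of the polynomials $\mathcal{H}_y$ and $\mathcal{H}_x$. For a polynomial map $f=(f_1,f_2):\mathbb{R}^2\to\mathbb{R}^2$, $\deg f=\max(\deg f_1,\deg f_2)$ and $Df$ is its Jacobian matrix. The origin is a center if it is an equilibrium with a punctured neighborhood filled with nonconstant periodic orbits. It is isochronous (of period $2\pi$) if all periodic orbits in some punctured neighborhood of the origin have the same minimal period $2\pi$. An isochronous center at the origin is called trivial if $\mathcal{H}=\tfrac12(f_1^2+f_2^2)$ for some polynomial map $f=(f_1,f_2):\mathbb{R}^2\to\mathbb{R}^2$ with $\det Df\equiv 1$ and $f(0,0)=(0,0)$. A trivial isochronous Hamiltonian is one whose Hamiltonian system has a trivial isochronous center at the origin.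
   Formalization: The degree claims (deg f = 2m, n = 2 deg f − 1 = 4m − 1 ≡ 3 mod 4) are stated under the added condition β_m ≠ 0, without which deg f < 2m (e.g. all β_i = 0 gives deg f = 2); det Df ≡ 1 and triviality are proved for all β. *)

theory Defs
  imports
    "HOL-Analysis.Analysis"
    "HOL-Computational_Algebra.Polynomial"
    "HOL-Number_Theory.Cong"
begin

section \<open>Real polynomials in two variables\<close>

text \<open>An element of \<open>\<real>[x,y]\<close> is represented in \<open>\<real>[x][y]\<close>: the outer variable is \<open>y\<close>, so
  the coefficient of \<open>x\<^sup>i y\<^sup>j\<close> in \<open>p\<close> is \<open>coeff (coeff p j) i\<close>.\<close>

type_synonym bipoly = "real poly poly"

definition bconst :: "real \<Rightarrow> bipoly" where
  "bconst c = [:[:c:]:]"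

definition bX :: bipoly where
  "bX = [:[:0, 1:]:]"

definition bY :: bipoly where
  "bY = [:0, 1:]"

definition eval2 :: "bipoly \<Rightarrow> real^2 \<Rightarrow> real" where
  "eval2 p z = poly (poly p [:z $ 2:]) (z $ 1)"

definition dx :: "bipoly \<Rightarrow> bipoly" where
  "dx p = map_poly pderiv p"

definition dy :: "bipoly \<Rightarrow> bipoly" where
  "dy p = pderiv p"

text \<open>Total degree; the zero polynomial gets degree 0, as for \<^const>\<open>degree\<close>.\<close>

definition total_degree :: "bipoly \<Rightarrow> nat" where
  "total_degree p = Max (insert 0 {i + j | i j. coeff (coeff p j) i \<noteq> 0})"

lemma finite_support: "finite {i + j | i j. coeff (coeff (p :: bipoly) j) i \<noteq> 0}"
proof -
  have "{i + j | i j. coeff (coeff p j) i \<noteq> 0} \<subseteq>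
      (\<Union>j\<le>degree p. (\<lambda>i. i + j) ` {..degree (coeff p j)})"
  proof
    fix k assume "k \<in> {i + j | i j. coeff (coeff p j) i \<noteq> 0}"
    then obtain i j where k: "k = i + j" and nz: "coeff (coeff p j) i \<noteq> 0" by blast
    then have "coeff p j \<noteq> 0" by auto
    then have "j \<le> degree p" "i \<le> degree (coeff p j)" using nz le_degree by blast+
    then show "k \<in> (\<Union>j\<le>degree p. (\<lambda>i. i + j) ` {..degree (coeff p j)})" using k by auto
  qed
  then show ?thesis by (rule finite_subset) auto
qed

lemma eval2_bconst [simp]: "eval2 (bconst c) z = c"
  by (simp add: eval2_def bconst_def)

lemma eval2_bX [simp]: "eval2 bX z = z $ 1"
  by (simp add: eval2_def bX_def)

lemma eval2_bY [simp]: "eval2 bY z = z $ 2"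
  by (simp add: eval2_def bY_def)

lemma eval2_add [simp]: "eval2 (p + q) z = eval2 p z + eval2 q z"
  by (simp add: eval2_def)

lemma eval2_mult [simp]: "eval2 (p * q) z = eval2 p z * eval2 q z"
  by (simp add: eval2_def)

lemma dx_pCons: "dx (pCons a p) = pCons (pderiv a) (dx p)"
  by (simp add: dx_def map_poly_pCons)

lemma has_derivative_eval2:
  "(eval2 p has_derivative (\<lambda>h. eval2 (dx p) z * h $ 1 + eval2 (dy p) z * h $ 2)) (at z)"
proof (induction p)
  case 0
  then show ?case by (simp add: eval2_def[abs_def] dx_def dy_def)
next
  case (pCons a p)
  have split: "eval2 (pCons a p) = (\<lambda>w. poly a (w $ 1) + w $ 2 * eval2 p w)"
    by (simp add: fun_eq_iff eval2_def)
  have nth: "((\<lambda>w. w $ i) has_derivative (\<lambda>h. h $ i)) (at z)" for i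
    by (rule bounded_linear.has_derivative[OF bounded_linear_vec_nth has_derivative_ident])
  have "((\<lambda>w. poly a (w $ 1)) has_derivative (\<lambda>h. poly (pderiv a) (z $ 1) * h $ 1)) (at z)"
    by (rule DERIV_compose_FDERIV[OF poly_DERIV, THEN has_derivative_eq_rhs])
       (auto intro!: nth simp: mult.commute)
  note this [derivative_intros] nth [derivative_intros] pCons.IH [derivative_intros]
  show ?case unfolding split
    by (rule has_derivative_eq_rhs, (rule derivative_intros)+)
       (auto simp: fun_eq_iff eval2_def dy_def pderiv_pCons dx_pCons algebra_simps)
qed


section \<open>Polynomial maps of the plane\<close>

definition map_degree :: "bipoly \<times> bipoly \<Rightarrow> nat" where
  "map_degree f = max (total_degree (fst f)) (total_degree (snd f))"

definition poly_map :: "bipoly \<times> bipoly \<Rightarrow> real^2 \<Rightarrow> real^2" where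
  "poly_map f z = vector [eval2 (fst f) z, eval2 (snd f) z]"


section \<open>Hamiltonian systems and isochronous centers\<close>

definition ham_field :: "bipoly \<Rightarrow> real^2 \<Rightarrow> real^2" where
  "ham_field H z = vector [- eval2 (dy H) z, eval2 (dx H) z]"

definition system_degree :: "bipoly \<Rightarrow> nat" where
  "system_degree H = max (total_degree (dy H)) (total_degree (dx H))"

definition ham_solution :: "bipoly \<Rightarrow> (real \<Rightarrow> real^2) \<Rightarrow> bool" where
  "ham_solution H \<gamma> \<longleftrightarrow> (\<forall>t. (\<gamma> has_vector_derivative ham_field H (\<gamma> t)) (at t))"

definition is_period :: "(real \<Rightarrow> 'a) \<Rightarrow> real \<Rightarrow> bool" where
  "is_period \<gamma> T \<longleftrightarrow> T > 0 \<and> (\<forall>t. \<gamma> (t + T) = \<gamma> t)"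

definition minimal_period :: "(real \<Rightarrow> 'a) \<Rightarrow> real \<Rightarrow> bool" where
  "minimal_period \<gamma> T \<longleftrightarrow> is_period \<gamma> T \<and> (\<forall>S. is_period \<gamma> S \<longrightarrow> T \<le> S)"

definition periodic_orbit :: "bipoly \<Rightarrow> (real \<Rightarrow> real^2) \<Rightarrow> bool" where
  "periodic_orbit H \<gamma> \<longleftrightarrow>
     ham_solution H \<gamma> \<and> (\<exists>T. is_period \<gamma> T) \<and> (\<exists>s t. \<gamma> s \<noteq> \<gamma> t)"

text \<open>The punctured neighborhood \<open>U - {0}\<close> is a union of nonconstant periodic orbits.\<close>

definition center_at_origin :: "bipoly \<Rightarrow> bool" where
  "center_at_origin H \<longleftrightarrow>
     ham_field H 0 = 0 \<and>
     (\<exists>U. open U \<and> 0 \<in> U \<and>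
        (\<forall>z\<in>U - {0}. \<exists>\<gamma>. periodic_orbit H \<gamma> \<and> z \<in> range \<gamma> \<and> range \<gamma> \<subseteq> U - {0}))"

definition isochronous_center :: "bipoly \<Rightarrow> bool" where
  "isochronous_center H \<longleftrightarrow>
     center_at_origin H \<and>
     (\<exists>V. open V \<and> 0 \<in> V \<and>
        (\<forall>\<gamma>. periodic_orbit H \<gamma> \<and> range \<gamma> \<subseteq> V - {0} \<longrightarrow> minimal_period \<gamma> (2 * pi)))"

definition trivial_isochronous :: "bipoly \<Rightarrow> bool" where
  "trivial_isochronous H \<longleftrightarrow>
     isochronous_center H \<and>
     (\<exists>f1 f2. H = bconst (1/2) * (f1\<^sup>2 + f2\<^sup>2) \<and>
        (\<forall>z. det (jacobian (poly_map (f1, f2)) (at z)) = 1) \<and>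
        poly_map (f1, f2) 0 = 0)"

end

theory Submission
  imports Defs
begin

text \<open>
  The map \<open>f\<close> is a composition of shears and linear maps: \<open>Q\<close> is \<open>y\<close> sheared by \<open>\<Gamma> x\<^sup>2\<close>, then
  \<open>x\<close> is sheared by the polynomial \<open>\<Sum>i. \<beta>\<^sub>i Q\<^sup>i\<close> in \<open>Q\<close>, then \<open>\<lambda> f\<^sub>1\<close> is added to \<open>Q\<close>. Each step has
  Jacobian determinant 1 and can be undone polynomially, so \<open>f\<close> is an automorphism of the plane
  with polynomial inverse \<open>g\<close>, fixing the origin.

  When \<open>det Df = 1\<close>, the map \<open>f\<close> is symplectic, and \<open>H = (f\<^sub>1\<^sup>2 + f\<^sub>2\<^sup>2) / 2\<close> is the pull-back of the
  harmonic oscillator: along a solution the pair \<open>(f\<^sub>1, f\<^sub>2)\<close> satisfies \<open>u' = -v, v' = u\<close>, that is,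
  it rotates with unit angular speed (\<open>ham_solution_rotates\<close>). Conversely the preimage under \<open>f\<close> of
  a rotating vector solves the Hamiltonian system (\<open>ham_solution_conjugate_rotation\<close>). Since
  \<open>f\<close> is bijective here, every point other than the origin lies on a nonconstant orbit with minimal
  period \<open>2\<pi>\<close>, so the isochronous center is global (\<open>trivial_isochronous_automorphism\<close>).

  For the degrees, the upper bounds are subadditivity of the total degree under products. When
  \<open>\<beta>\<^sub>m\<close> and \<open>\<Gamma>\<close> are nonzero they are attained on the line \<open>y = 0\<close>: there \<open>f\<^sub>1\<close> has the term \<open>\<beta>\<^sub>m \<Gamma>\<^sup>m x\<^sup>2\<^sup>m\<close>, and in \<open>H\<close> the leading
  terms cannot cancel because they are squares of real numbers.
\<close>

section \<open>Evaluation and partial derivatives\<close>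

lemma eval2_zero [simp]: "eval2 0 z = 0"
  by (simp add: eval2_def)

lemma eval2_one [simp]: "eval2 1 z = 1"
  by (simp add: eval2_def)

lemma eval2_numeral [simp]: "eval2 (numeral n) z = numeral n"
  by (simp add: eval2_def)

lemma eval2_diff [simp]: "eval2 (p - q) z = eval2 p z - eval2 q z"
  by (simp add: eval2_def)

lemma eval2_power [simp]: "eval2 (p ^ n) z = eval2 p z ^ n"
  by (simp add: eval2_def)

lemma eval2_sum [simp]: "eval2 (sum p A) z = (\<Sum>i\<in>A. eval2 (p i) z)"
  by (induction A rule: infinite_finite_induct) auto

lemma coeff_dx: "coeff (dx p) j = pderiv (coeff p j)"
  by (simp add: dx_def coeff_map_poly)

lemma dx_add: "dx (p + q) = dx p + dx q"
  by (simp add: poly_eq_iff[where 'a = "real poly"] coeff_dx pderiv_add)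

lemma dx_smult: "dx (smult a q) = smult (pderiv a) q + smult a (dx q)"
  by (simp add: poly_eq_iff[where 'a = "real poly"] coeff_dx pderiv_mult algebra_simps)

lemma dx_mult: "dx (p * q) = p * dx q + dx p * q"
proof (induction p)
  case 0
  then show ?case by (simp add: dx_def)
next
  case (pCons a p)
  then show ?case by (simp add: dx_add dx_smult dx_pCons algebra_simps)
qed

lemma dx_0 [simp]: "dx 0 = 0"
  by (simp add: dx_def)

lemma dx_simps [simp]: "dx (bconst c) = 0" "dx bX = 1" "dx bY = 0"
  by (simp_all add: bconst_def bX_def bY_def dx_pCons pderiv_pCons one_pCons)

lemma dy_simps [simp]: "dy (bconst c) = 0" "dy bX = 0" "dy bY = 1"
  by (simp_all add: bconst_def bX_def bY_def dy_def pderiv_pCons one_pCons)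

lemma dy_add: "dy (p + q) = dy p + dy q"
  by (simp add: dy_def pderiv_add)

lemma dy_mult: "dy (p * q) = p * dy q + dy p * q"
  by (simp add: dy_def pderiv_mult algebra_simps)

text \<open>The chain rule for any derivation \<open>D\<close> that kills constants. The outer derivative does not
  depend on \<open>D\<close>, which is what makes the cross terms cancel in the Jacobian determinant.\<close>

lemma derivation_polynomial:
  fixes D :: "bipoly \<Rightarrow> bipoly"
  assumes add: "\<And>p q. D (p + q) = D p + D q"
    and mult: "\<And>p q. D (p * q) = p * D q + D p * q"
    and const: "\<And>c. D (bconst c) = 0"
  shows "D (\<Sum>i=1..m. bconst (\<beta> i) * Q ^ i)
    = (\<Sum>i=1..m. bconst (\<beta> i) * of_nat i * Q ^ (i - 1)) * D Q"
proof -
  have zero: "D 0 = 0"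
    using add[of 0 0] by simp
  have one: "D 1 = 0"
    using const[of 1] by (simp add: bconst_def one_pCons)
  have power: "D (Q ^ Suc n) = of_nat (Suc n) * Q ^ n * D Q" for n
    by (induction n) (simp_all add: mult one algebra_simps)
  show ?thesis
  proof (induction m)
    case 0
    then show ?case by (simp add: zero)
  next
    case (Suc m)
    then show ?case by (simp add: add mult const power algebra_simps del: power_Suc of_nat_Suc)
  qed
qed

lemma poly_map_nth [simp]:
  "poly_map (p, q) z $ 1 = eval2 p z" "poly_map (p, q) z $ 2 = eval2 q z"
  by (simp_all add: poly_map_def)

lemma vec2_eq_iff: "(v :: 'a^2) = w \<longleftrightarrow> v $ 1 = w $ 1 \<and> v $ 2 = w $ 2"
  by (simp add: vec_eq_iff forall_2)

lemma has_derivative_vec2: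
  fixes F :: "'a::real_normed_vector \<Rightarrow> real^2"
  assumes "((\<lambda>z. F z $ 1) has_derivative (\<lambda>h. F' h $ 1)) (at z)"
    and "((\<lambda>z. F z $ 2) has_derivative (\<lambda>h. F' h $ 2)) (at z)"
  shows "(F has_derivative F') (at z)"
  unfolding has_derivative_componentwise_within[of F]
  using assms by (auto simp: Basis_vec_def inner_axis forall_2)

lemma has_derivative_poly_map:
  "(poly_map (p, q) has_derivative
     (\<lambda>h. vector [eval2 (dx p) z * h $ 1 + eval2 (dy p) z * h $ 2,
                  eval2 (dx q) z * h $ 1 + eval2 (dy q) z * h $ 2])) (at z)"
  by (rule has_derivative_vec2) (simp_all add: has_derivative_eval2)

lemma det_jacobian_poly_map:
  "det (jacobian (poly_map (p, q)) (at z)) = eval2 (dx p * dy q - dy p * dx q) z"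
  unfolding jacobian_def frechet_derivative_at[OF has_derivative_poly_map, symmetric]
  by (simp add: det_2 matrix_def axis_def)

lemma eval2_along_curve:
  assumes "(\<gamma> has_vector_derivative d) (at t)"
  shows "((\<lambda>t. eval2 p (\<gamma> t)) has_real_derivative
    eval2 (dx p) (\<gamma> t) * d $ 1 + eval2 (dy p) (\<gamma> t) * d $ 2) (at t)"
proof -
  have "((\<lambda>t. eval2 p (\<gamma> t)) has_derivative
      (\<lambda>h. eval2 (dx p) (\<gamma> t) * (h *\<^sub>R d) $ 1 + eval2 (dy p) (\<gamma> t) * (h *\<^sub>R d) $ 2)) (at t)"
    using has_derivative_compose[OF assms[unfolded has_vector_derivative_def] has_derivative_eval2]
    by simp
  then show ?thesis
    unfolding has_field_derivative_def
    by (rule has_derivative_eq_rhs) (simp add: fun_eq_iff algebra_simps)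
qed


section \<open>Pulling back the harmonic oscillator\<close>

definition rotation :: "real \<Rightarrow> real^2 \<Rightarrow> real^2" where
  "rotation t w = vector [cos t * w $ 1 - sin t * w $ 2, sin t * w $ 1 + cos t * w $ 2]"

lemma rotation_nth [simp]:
  "rotation t w $ 1 = cos t * w $ 1 - sin t * w $ 2"
  "rotation t w $ 2 = sin t * w $ 1 + cos t * w $ 2"
  by (simp_all add: rotation_def)

lemma rotation_0 [simp]: "rotation 0 w = w"
  by (simp add: vec2_eq_iff)

lemma rotation_eq_0_iff: "rotation t w = 0 \<longleftrightarrow> w = 0"
proof
  assume "rotation t w = 0"
  then have "0 = (rotation t w $ 1)\<^sup>2 + (rotation t w $ 2)\<^sup>2"
    by simp
  also have "\<dots> = ((sin t)\<^sup>2 + (cos t)\<^sup>2) * ((w $ 1)\<^sup>2 + (w $ 2)\<^sup>2)"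
    unfolding rotation_nth by algebra
  finally show "w = 0"
    by (simp add: vec2_eq_iff sum_power2_eq_zero_iff)
qed (simp add: vec2_eq_iff)

lemma rotation_2pi: "rotation (t + 2 * pi) w = rotation t w"
  by (simp add: vec2_eq_iff)

text \<open>The inner product of \<open>w\<close> with \<open>w - rotation t w\<close> is \<open>(1 - cos t) |w|\<^sup>2\<close>.\<close>

lemma rotation_fixed_imp_cos:
  assumes "rotation t w = w" "w \<noteq> 0"
  shows "cos t = 1"
proof -
  have e: "cos t * w $ 1 - sin t * w $ 2 = w $ 1" "sin t * w $ 1 + cos t * w $ 2 = w $ 2"
    using assms(1) by (simp_all add: vec2_eq_iff)
  have "(1 - cos t) * ((w $ 1)\<^sup>2 + (w $ 2)\<^sup>2)
      = w $ 1 * (w $ 1 - (cos t * w $ 1 - sin t * w $ 2))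
      + w $ 2 * (w $ 2 - (sin t * w $ 1 + cos t * w $ 2))"
    by (simp add: algebra_simps power2_eq_square)
  also have "\<dots> = 0"
    using e by simp
  finally show ?thesis
    using assms(2) by (auto simp: vec2_eq_iff sum_power2_eq_zero_iff)
qed

lemma minimal_period_rotation:
  assumes "w \<noteq> 0"
  shows "minimal_period (\<lambda>t. rotation t w) (2 * pi)"
  unfolding minimal_period_def
proof (intro conjI allI impI)
  show "is_period (\<lambda>t. rotation t w) (2 * pi)"
    by (simp add: is_period_def rotation_2pi)
next
  fix S assume S: "is_period (\<lambda>t. rotation t w) S"
  then have "rotation (0 + S) w = rotation 0 w"
    unfolding is_period_def by blast
  then have "cos S = 1"
    using rotation_fixed_imp_cos[OF _ assms] by simp
  then obtain k :: int where k: "S = k * 2 * pi"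
    by (auto simp: cos_one_2pi_int)
  then have "k \<ge> 1"
    using S by (simp add: is_period_def zero_less_mult_iff)
  then show "2 * pi \<le> S"
    using k by simp
qed

text \<open>Uniqueness for the harmonic oscillator: in the co-rotating frame the solution is constant.\<close>

lemma harmonic_oscillator_unique:
  fixes u v :: "real \<Rightarrow> real"
  assumes u: "\<And>t. (u has_real_derivative - v t) (at t)"
    and v: "\<And>t. (v has_real_derivative u t) (at t)"
  shows "u t = cos t * u 0 - sin t * v 0" "v t = sin t * u 0 + cos t * v 0"
proof -
  note [derivative_intros] = u v
  have "((\<lambda>t. u t * cos t + v t * sin t) has_real_derivative 0) (at t)" for t
    by (auto intro!: derivative_eq_intros)
  then have a: "u t * cos t + v t * sin t = u 0"
    using DERIV_isconst_all[of "\<lambda>t. u t * cos t + v t * sin t" t 0] by simp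
  have "((\<lambda>t. v t * cos t - u t * sin t) has_real_derivative 0) (at t)" for t
    by (auto intro!: derivative_eq_intros)
  then have b: "v t * cos t - u t * sin t = v 0"
    using DERIV_isconst_all[of "\<lambda>t. v t * cos t - u t * sin t" t 0] by simp
  have "cos t * u 0 - sin t * v 0 = u t * ((sin t)\<^sup>2 + (cos t)\<^sup>2)"
    unfolding a[symmetric] b[symmetric] by algebra
  then show "u t = cos t * u 0 - sin t * v 0" by simp
  have "sin t * u 0 + cos t * v 0 = v t * ((sin t)\<^sup>2 + (cos t)\<^sup>2)"
    unfolding a[symmetric] b[symmetric] by algebra
  then show "v t = sin t * u 0 + cos t * v 0" by simp
qed

lemma ham_field_half_norm:
  assumes "H = bconst (1/2) * (f1\<^sup>2 + f2\<^sup>2)"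
  shows "ham_field H z $ 1 = - (eval2 f1 z * eval2 (dy f1) z + eval2 f2 z * eval2 (dy f2) z)"
    and "ham_field H z $ 2 = eval2 f1 z * eval2 (dx f1) z + eval2 f2 z * eval2 (dx f2) z"
  by (simp_all add: assms ham_field_def power2_eq_square dx_mult dy_mult dx_add dy_add
      algebra_simps)

text \<open>The derivative of \<open>f\<close> along the field of \<open>H\<close> is \<open>Df J Df\<^sup>T f = det Df \<cdot> J f\<close>, where \<open>J\<close> is the
  rotation by a right angle.\<close>

lemma ham_solution_rotates:
  assumes H: "H = bconst (1/2) * (f1\<^sup>2 + f2\<^sup>2)"
    and det: "\<And>z. eval2 (dx f1 * dy f2 - dy f1 * dx f2) z = 1"
    and sol: "ham_solution H \<gamma>"
  shows "poly_map (f1, f2) (\<gamma> t) = rotation t (poly_map (f1, f2) (\<gamma> 0))"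
proof -
  have d: "(\<gamma> has_vector_derivative ham_field H (\<gamma> t)) (at t)" for t
    using sol by (simp add: ham_solution_def)
  have "eval2 (dx f1) z * ham_field H z $ 1 + eval2 (dy f1) z * ham_field H z $ 2
      = - (eval2 f2 z * eval2 (dx f1 * dy f2 - dy f1 * dx f2) z)" for z
    by (simp add: ham_field_half_norm[OF H] algebra_simps)
  then have u: "((\<lambda>t. eval2 f1 (\<gamma> t)) has_real_derivative - eval2 f2 (\<gamma> t)) (at t)" for t
    using eval2_along_curve[OF d, of f1] unfolding det by simp
  have "eval2 (dx f2) z * ham_field H z $ 1 + eval2 (dy f2) z * ham_field H z $ 2
      = eval2 f1 z * eval2 (dx f1 * dy f2 - dy f1 * dx f2) z" for z
    by (simp add: ham_field_half_norm[OF H] algebra_simps)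
  then have v: "((\<lambda>t. eval2 f2 (\<gamma> t)) has_real_derivative eval2 f1 (\<gamma> t)) (at t)" for t
    using eval2_along_curve[OF d, of f2] unfolding det by simp
  show ?thesis
    unfolding vec2_eq_iff poly_map_nth rotation_nth
    using harmonic_oscillator_unique[OF u v] by blast
qed

lemma has_real_derivative_rotation:
  "((\<lambda>t. rotation t w $ 1) has_real_derivative - rotation t w $ 2) (at t)"
  "((\<lambda>t. rotation t w $ 2) has_real_derivative rotation t w $ 1) (at t)"
  by (auto intro!: derivative_eq_intros)

lemma has_vector_derivative_rotation:
  "((\<lambda>t. rotation t w) has_vector_derivative vector [- rotation t w $ 2, rotation t w $ 1]) (at t)"
proof -
  show ?thesis
    using has_real_derivative_rotation[of w t] unfolding has_vector_derivative_def
    by (intro has_derivative_vec2) (simp_all add: has_field_derivative_def mult.commute[of _ "_ $ _"]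
        mult_commute_abs)
qed

text \<open>The velocity of the curve is found without differentiating \<open>g\<close> explicitly: \<open>f\<close> maps it to
  the rotation, so \<open>Df\<close> sends its velocity to \<open>J f\<close>, and \<open>Df\<close> is inverted by Cramer's rule.\<close>

lemma ham_solution_conjugate_rotation:
  assumes H: "H = bconst (1/2) * (f1\<^sup>2 + f2\<^sup>2)"
    and det: "\<And>z. eval2 (dx f1 * dy f2 - dy f1 * dx f2) z = 1"
    and fg: "\<And>w. poly_map (f1, f2) (g w) = w"
    and g: "\<And>w. g differentiable (at w)"
  shows "ham_solution H (\<lambda>t. g (rotation t w))"
  unfolding ham_solution_def
proof
  fix t
  define z where "z = g (rotation t w)"
  have "(\<lambda>t. g (rotation t w)) differentiable (at t)"
    using differentiable_chain_at[OF differentiableI_vector[OF has_vector_derivative_rotation] g]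
    by (simp add: o_def)
  then obtain d where d: "((\<lambda>t. g (rotation t w)) has_vector_derivative d) (at t)"
    using vector_derivative_works by blast
  have f: "eval2 f1 (g v) = v $ 1" "eval2 f2 (g v) = v $ 2" for v
    using fg[of v] by (simp_all add: vec2_eq_iff)
  have e1: "eval2 (dx f1) z * d $ 1 + eval2 (dy f1) z * d $ 2 = - eval2 f2 z"
    and e2: "eval2 (dx f2) z * d $ 1 + eval2 (dy f2) z * d $ 2 = eval2 f1 z"
    using eval2_along_curve[OF d, of f1] eval2_along_curve[OF d, of f2]
      has_real_derivative_rotation[of w t] DERIV_unique
    unfolding f z_def by blast+
  have dt: "eval2 (dx f1) z * eval2 (dy f2) z - eval2 (dy f1) z * eval2 (dx f2) z = 1"
    using det[of z] by simp
  have "d $ 1 = (eval2 (dx f1) z * eval2 (dy f2) z - eval2 (dy f1) z * eval2 (dx f2) z) * d $ 1"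
    by (simp add: dt)
  also have "\<dots> = eval2 (dy f2) z * (eval2 (dx f1) z * d $ 1 + eval2 (dy f1) z * d $ 2)
      - eval2 (dy f1) z * (eval2 (dx f2) z * d $ 1 + eval2 (dy f2) z * d $ 2)"
    by (simp add: algebra_simps)
  finally have d1: "d $ 1 = ham_field H z $ 1"
    unfolding e1 e2 by (simp add: ham_field_half_norm[OF H] algebra_simps)
  have "d $ 2 = (eval2 (dx f1) z * eval2 (dy f2) z - eval2 (dy f1) z * eval2 (dx f2) z) * d $ 2"
    by (simp add: dt)
  also have "\<dots> = eval2 (dx f1) z * (eval2 (dx f2) z * d $ 1 + eval2 (dy f2) z * d $ 2)
      - eval2 (dx f2) z * (eval2 (dx f1) z * d $ 1 + eval2 (dy f1) z * d $ 2)"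
    by (simp add: algebra_simps)
  finally have d2: "d $ 2 = ham_field H z $ 2"
    unfolding e1 e2 by (simp add: ham_field_half_norm[OF H] algebra_simps)
  have "d = ham_field H z"
    using d1 d2 by (simp add: vec2_eq_iff)
  then show "((\<lambda>t. g (rotation t w)) has_vector_derivative ham_field H (g (rotation t w))) (at t)"
    using d by (simp add: z_def)
qed

lemma minimal_period_inj:
  assumes "inj f"
  shows "minimal_period (\<lambda>t. f (\<gamma> t)) T \<longleftrightarrow> minimal_period \<gamma> T"
  using assms by (simp add: minimal_period_def is_period_def inj_eq)

text \<open>Bijectivity of \<open>f\<close> lets the whole plane serve as the neighborhood in the definitions of a
  center and of an isochronous center.\<close>

lemma trivial_isochronous_automorphism:
  assumes H: "H = bconst (1/2) * (f1\<^sup>2 + f2\<^sup>2)"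
    and jac: "\<And>z. det (jacobian (poly_map (f1, f2)) (at z)) = 1"
    and f0: "poly_map (f1, f2) 0 = 0"
    and gf: "\<And>z. g (poly_map (f1, f2) z) = z"
    and fg: "\<And>w. poly_map (f1, f2) (g w) = w"
    and g: "\<And>w. g differentiable (at w)"
  shows "trivial_isochronous H"
proof -
  let ?f = "poly_map (f1, f2)"
  have det: "eval2 (dx f1 * dy f2 - dy f1 * dx f2) z = 1" for z
    using jac[of z] by (simp only: det_jacobian_poly_map)
  have inj: "inj ?f"
    using gf by (rule inj_on_inverseI)
  have min_period: "minimal_period \<gamma> (2 * pi)" if sol: "ham_solution H \<gamma>" and nz: "\<gamma> 0 \<noteq> 0" for \<gamma>
  proof -
    have "?f (\<gamma> 0) \<noteq> 0"
      using nz inj_eq[OF inj] f0 by metis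
    moreover have "(\<lambda>t. ?f (\<gamma> t)) = (\<lambda>t. rotation t (?f (\<gamma> 0)))"
      by (rule ext) (rule ham_solution_rotates[OF H det sol])
    ultimately have "minimal_period (\<lambda>t. ?f (\<gamma> t)) (2 * pi)"
      using minimal_period_rotation by metis
    then show ?thesis
      by (simp add: minimal_period_inj[OF inj])
  qed
  have orbit: "\<exists>\<gamma>. periodic_orbit H \<gamma> \<and> z \<in> range \<gamma> \<and> range \<gamma> \<subseteq> UNIV - {0}" if "z \<noteq> 0" for z
  proof -
    define \<gamma> where "\<gamma> = (\<lambda>t. g (rotation t (?f z)))"
    have sol: "ham_solution H \<gamma>"
      unfolding \<gamma>_def using H det fg g by (rule ham_solution_conjugate_rotation)
    have \<gamma>0: "\<gamma> 0 = z"
      by (simp add: \<gamma>_def gf)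
    have per: "minimal_period \<gamma> (2 * pi)"
      using min_period[OF sol] \<gamma>0 that by simp
    have w: "?f z \<noteq> 0"
      using that inj_eq[OF inj] f0 by metis
    have avoid: "\<gamma> t \<noteq> 0" for t
    proof
      assume "\<gamma> t = 0"
      then have "rotation t (?f z) = 0"
        using fg f0 unfolding \<gamma>_def by metis
      then show False
        using w rotation_eq_0_iff by blast
    qed
    \<comment> \<open>A constant curve would have \<open>1 < 2\<pi>\<close> as a period.\<close>
    have "\<exists>s t. \<gamma> s \<noteq> \<gamma> t"
    proof (rule ccontr)
      assume "\<not> (\<exists>s t. \<gamma> s \<noteq> \<gamma> t)"
      then have "is_period \<gamma> 1"
        by (simp add: is_period_def)
      then have "2 * pi \<le> 1"
        using per by (simp add: minimal_period_def)
      then show False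
        using pi_gt3 by simp
    qed
    then have "periodic_orbit H \<gamma>"
      using sol per by (auto simp: periodic_orbit_def minimal_period_def)
    then show ?thesis
      using avoid \<gamma>0 by (intro exI[of _ \<gamma>]) auto
  qed
  have "eval2 f1 0 = 0" "eval2 f2 0 = 0"
    using f0 by (simp_all add: vec2_eq_iff)
  then have "ham_field H 0 = 0"
    by (simp add: vec2_eq_iff ham_field_half_norm[OF H])
  then have "center_at_origin H"
    unfolding center_at_origin_def using orbit by (intro conjI exI[of _ UNIV]) auto
  moreover have "minimal_period \<gamma> (2 * pi)"
    if "periodic_orbit H \<gamma>" "range \<gamma> \<subseteq> UNIV - {0}" for \<gamma>
    using that by (intro min_period) (auto simp: periodic_orbit_def)
  ultimately have "isochronous_center H"
    unfolding isochronous_center_def by (intro conjI exI[of _ UNIV]) auto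
  then show ?thesis
    unfolding trivial_isochronous_def using H jac f0 by blast
qed


section \<open>Total degree\<close>

lemma total_degree_le_iff:
  "total_degree p \<le> n \<longleftrightarrow> (\<forall>i j. coeff (coeff p j) i \<noteq> 0 \<longrightarrow> i + j \<le> n)"
  using finite_support[of p] by (auto simp: total_degree_def)

lemma total_degree_ge:
  assumes "coeff (coeff p j) i \<noteq> 0"
  shows "i + j \<le> total_degree p"
  using assms total_degree_le_iff[of p "total_degree p"] by blast

lemma degree_coeff_le_total_degree: "degree (coeff p 0) \<le> total_degree p"
  using total_degree_ge[of p 0] by (cases "coeff p 0 = 0") (auto simp: leading_coeff_neq_0)

lemma total_degree_add_le:
  assumes "total_degree p \<le> n" "total_degree q \<le> n"
  shows "total_degree (p + q) \<le> n"
  using assms unfolding total_degree_le_iff by (metis add.right_neutral coeff_add)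

lemma total_degree_mult_le:
  assumes p: "total_degree p \<le> k" and q: "total_degree q \<le> l"
  shows "total_degree (p * q) \<le> k + l"
  unfolding total_degree_le_iff
proof (intro allI impI)
  fix i j assume "coeff (coeff (p * q) j) i \<noteq> 0"
  then have "(\<Sum>a\<le>j. \<Sum>b\<le>i. coeff (coeff p a) b * coeff (coeff q (j - a)) (i - b)) \<noteq> 0"
    by (simp add: coeff_mult coeff_sum)
  then obtain a b where ab: "a \<le> j" "b \<le> i"
      and nz: "coeff (coeff p a) b * coeff (coeff q (j - a)) (i - b) \<noteq> 0"
    by (metis (no_types, lifting) atMost_iff sum.not_neutral_contains_not_neutral)
  have "b + a \<le> k" "(i - b) + (j - a) \<le> l"
    using p q nz unfolding total_degree_le_iff by (metis mult_zero_left mult_zero_right)+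
  then show "i + j \<le> k + l"
    using ab by simp
qed

lemma total_degree_bconst [simp]: "total_degree (bconst c) = 0"
proof -
  have "total_degree (bconst c) \<le> 0"
    unfolding total_degree_le_iff by (auto simp: bconst_def coeff_pCons split: nat.splits)
  then show ?thesis by simp
qed

lemma total_degree_bX: "total_degree bX \<le> 1"
  by (auto simp: total_degree_le_iff bX_def coeff_pCons split: nat.splits)

lemma total_degree_bY: "total_degree bY \<le> 1"
  by (auto simp: total_degree_le_iff bY_def coeff_pCons split: nat.splits)

lemma total_degree_power_le:
  assumes "total_degree p \<le> k"
  shows "total_degree (p ^ n) \<le> n * k"
proof (induction n)
  case 0
  show ?case
    using total_degree_bconst[of 1] by (simp add: bconst_def flip: one_pCons)
next
  case (Suc n)
  then show ?case using total_degree_mult_le[OF assms] by simp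
qed

lemma total_degree_bconst_mult_le:
  assumes "total_degree p \<le> n"
  shows "total_degree (bconst c * p) \<le> n"
  using total_degree_mult_le[of "bconst c" 0 p n] assms by simp

lemma total_degree_sum_le:
  assumes "\<And>i. i \<in> A \<Longrightarrow> total_degree (p i) \<le> n"
  shows "total_degree (sum p A) \<le> n"
  using assms
proof (induction A rule: infinite_finite_induct)
  case (insert a A)
  then show ?case by (simp add: total_degree_add_le)
qed (simp_all add: total_degree_def)

lemma total_degree_dx_le: "total_degree (dx p) \<le> total_degree p - 1"
  unfolding total_degree_le_iff
proof (intro allI impI)
  fix i j assume "coeff (coeff (dx p) j) i \<noteq> 0"
  then have "coeff (coeff p j) (Suc i) \<noteq> 0"
    by (auto simp: coeff_dx coeff_pderiv)
  from total_degree_ge[OF this] show "i + j \<le> total_degree p - 1" by simp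
qed

lemma total_degree_dy_le: "total_degree (dy p) \<le> total_degree p - 1"
  unfolding total_degree_le_iff
proof (intro allI impI)
  fix i j assume "coeff (coeff (dy p) j) i \<noteq> 0"
  then have "coeff (coeff p (Suc j)) i \<noteq> 0"
    by (auto simp: dy_def coeff_pderiv of_nat_poly simp del: of_nat_Suc)
  from total_degree_ge[OF this] show "i + j \<le> total_degree p - 1" by simp
qed

lemma coeff_square_top:
  fixes p :: "'a::idom poly"
  assumes "degree p \<le> n"
  shows "coeff (p\<^sup>2) (2 * n) = (coeff p n)\<^sup>2"
proof (cases "degree p = n")
  case True
  then show ?thesis
    using coeff_mult_degree_sum[of p p] by (simp add: power2_eq_square mult_2)
next
  case False
  then have "degree (p * p) < 2 * n"
    using degree_mult_le[of p p] assms by simp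
  then show ?thesis
    using False assms by (simp add: power2_eq_square coeff_eq_0)
qed

text \<open>On the line \<open>y = 0\<close> the coefficient of \<open>x\<^bsup>2d\<^esup>\<close> in \<open>H\<close> is \<open>(a\<^sup>2 + b\<^sup>2) / 2\<close>, where \<open>a\<close> and \<open>b\<close> are
  the coefficients of \<open>x\<^sup>d\<close> in \<open>f\<^sub>1\<close> and \<open>f\<^sub>2\<close>. It is positive as soon as \<open>a \<noteq> 0\<close>, and it survives
  differentiation with respect to \<open>x\<close>.\<close>

lemma system_degree_half_norm:
  assumes H: "H = bconst (1/2) * (f1\<^sup>2 + f2\<^sup>2)"
    and f1: "total_degree f1 \<le> d" and f2: "total_degree f2 \<le> d"
    and nz: "coeff (coeff f1 0) d \<noteq> 0" and d: "d \<ge> 1"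
  shows "map_degree (f1, f2) = d" "system_degree H = 2 * d - 1"
proof -
  have "d \<le> total_degree f1"
    using total_degree_ge[OF nz] by simp
  then show "map_degree (f1, f2) = d"
    using f1 f2 by (simp add: map_degree_def)
  have "total_degree H \<le> 2 * d"
    unfolding H by (intro total_degree_bconst_mult_le total_degree_add_le total_degree_power_le f1 f2)
  then have upper: "system_degree H \<le> 2 * d - 1"
    using total_degree_dx_le[of H] total_degree_dy_le[of H]
    unfolding system_degree_def by (intro max.boundedI) linarith+
  have "degree (coeff f1 0) \<le> d" "degree (coeff f2 0) \<le> d"
    using f1 f2 degree_coeff_le_total_degree le_trans by blast+
  moreover have "coeff H 0 = smult (1/2) ((coeff f1 0)\<^sup>2 + (coeff f2 0)\<^sup>2)"
    by (simp add: H bconst_def power2_eq_square coeff_mult)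
  ultimately have "coeff (coeff H 0) (2 * d) = ((coeff (coeff f1 0) d)\<^sup>2 + (coeff (coeff f2 0) d)\<^sup>2) / 2"
    by (simp add: coeff_square_top)
  moreover have "(coeff (coeff f1 0) d)\<^sup>2 + (coeff (coeff f2 0) d)\<^sup>2 > 0"
    using nz by (simp add: sum_power2_gt_zero_iff)
  ultimately have "coeff (coeff H 0) (2 * d) \<noteq> 0"
    by simp
  then have "coeff (coeff (dx H) 0) (2 * d - 1) \<noteq> 0"
    using d by (simp add: coeff_dx coeff_pderiv)
  from total_degree_ge[OF this] have "2 * d - 1 \<le> system_degree H"
    by (simp add: system_degree_def)
  with upper show "system_degree H = 2 * d - 1"
    by simp
qed


section \<open>The family of sheared maps\<close>

text \<open>With \<open>D = \<Sum>i. i \<beta>\<^sub>i Q\<^bsup>i-1\<^esup>\<close>, the gradient of \<open>f\<^sub>1\<close> is \<open>(1, 0) + D \<nabla>Q\<close>, and the gradient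
  of \<open>f\<^sub>2\<close> is \<open>\<nabla>Q + \<lambda> \<nabla>f\<^sub>1\<close>. The determinant is alternating, so the terms \<open>\<lambda> \<nabla>f\<^sub>1\<close> and
  \<open>D \<nabla>Q\<close> drop out and \<open>Q\<^sub>y = 1\<close> remains.\<close>

lemma jacobian_determinant_shear:
  assumes Q: "Q = bY + bconst \<Gamma> * bX\<^sup>2"
    and f1: "f1 = bX + (\<Sum>i=1..m. bconst (\<beta> i) * Q ^ i)"
    and f2: "f2 = Q + bconst lam * f1"
  shows "dx f1 * dy f2 - dy f1 * dx f2 = 1"
proof -
  define D where "D = (\<Sum>i=1..m. bconst (\<beta> i) * of_nat i * Q ^ (i - 1))"
  have "dx f1 = 1 + D * dx Q"
    unfolding f1 D_def by (subst dx_add, subst derivation_polynomial[of dx])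
      (simp_all add: dx_add dx_mult)
  moreover have "dy f1 = D * dy Q"
    unfolding f1 D_def by (subst dy_add, subst derivation_polynomial[of dy])
      (simp_all add: dy_add dy_mult)
  moreover have "dy Q = 1"
    by (simp add: Q dy_add dy_mult power2_eq_square)
  ultimately show ?thesis
    by (simp add: f2 dx_add dy_add dx_mult dy_mult algebra_simps)
qed

lemma coeff_on_x_axis_shear:
  assumes Q: "Q = bY + bconst \<Gamma> * bX\<^sup>2"
    and f1: "f1 = bX + (\<Sum>i=1..m. bconst (\<beta> i) * Q ^ i)" and m: "m \<ge> 1"
  shows "coeff (coeff f1 0) (2 * m) = \<beta> m * \<Gamma> ^ m"
proof -
  have Q0: "poly Q 0 = monom \<Gamma> 2"
    by (simp add: Q bY_def bX_def bconst_def monom_altdef)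
  have x: "[:0, 1:] = monom (1 :: real) (Suc 0)"
    by (simp add: monom_altdef)
  have "coeff f1 0 = poly f1 0"
    by (simp add: poly_0_coeff_0)
  also have "\<dots> = monom 1 1 + (\<Sum>i=1..m. monom (\<beta> i * \<Gamma> ^ i) (2 * i))"
    by (simp add: f1 poly_sum Q0 bX_def bconst_def monom_power smult_monom mult.commute x)
  finally have "coeff (coeff f1 0) (2 * m)
      = (\<Sum>i=1..m. if i = m then \<beta> i * \<Gamma> ^ i else 0)"
    by (simp add: coeff_sum)
  then show ?thesis
    using m by (simp add: sum.delta)
qed

theorem proposition3p1:
  fixes m :: nat and \<Gamma> lam :: real and \<beta> :: "nat \<Rightarrow> real"
    and Q f1 f2 H :: bipoly
  assumes "m \<ge> 2" and "\<Gamma> \<noteq> 0"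
    and "Q = bY + bconst \<Gamma> * bX\<^sup>2"
    and "f1 = bX + (\<Sum>i=1..m. bconst (\<beta> i) * Q ^ i)"
    and "f2 = Q + bconst lam * f1"
    and "H = bconst (1/2) * (f1\<^sup>2 + f2\<^sup>2)"
  shows "(\<forall>z. det (jacobian (poly_map (f1, f2)) (at z)) = 1) \<and>
    trivial_isochronous H \<and>
    (\<beta> m \<noteq> 0 \<longrightarrow>
       map_degree (f1, f2) = 2 * m \<and>
       system_degree H = 2 * map_degree (f1, f2) - 1 \<and>
       system_degree H = 4 * m - 1 \<and>
       [system_degree H = 3] (mod 4))"
proof -
  have jac: "det (jacobian (poly_map (f1, f2)) (at z)) = 1" for z
    by (simp only: det_jacobian_poly_map jacobian_determinant_shear[OF assms(3-5)] eval2_one)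
  \<comment> \<open>The inverse undoes the shears in reverse order: \<open>f\<^sub>2 - \<lambda> f\<^sub>1\<close> is \<open>Q\<close>, which yields \<open>x\<close>, then \<open>y\<close>.\<close>
  define q where "q = bY - bconst lam * bX"
  define g1 where "g1 = bX - (\<Sum>i=1..m. bconst (\<beta> i) * q ^ i)"
  define g2 where "g2 = q - bconst \<Gamma> * g1\<^sup>2"
  have gf: "poly_map (g1, g2) (poly_map (f1, f2) z) = z" for z
    by (simp add: vec2_eq_iff g1_def g2_def q_def assms(3-5))
  have fg: "poly_map (f1, f2) (poly_map (g1, g2) w) = w" for w
    by (simp add: vec2_eq_iff g1_def g2_def q_def assms(3-5))
  have f0: "poly_map (f1, f2) 0 = 0"
    by (simp add: vec2_eq_iff assms(3-5) power_0_left)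
  have "trivial_isochronous H"
    by (rule trivial_isochronous_automorphism[OF assms(6) jac f0 gf fg])
      (rule differentiableI[OF has_derivative_poly_map])
  moreover have "map_degree (f1, f2) = 2 * m \<and> system_degree H = 2 * (2 * m) - 1" if "\<beta> m \<noteq> 0"
  proof -
    have "total_degree bX \<le> 2 * m" "total_degree bY \<le> 2"
      using total_degree_bX total_degree_bY assms(1) by linarith+
    moreover have "total_degree (bX\<^sup>2) \<le> 2"
      using total_degree_power_le[OF total_degree_bX, of 2] by simp
    ultimately have Q: "total_degree Q \<le> 2"
      unfolding assms(3) by (intro total_degree_add_le total_degree_bconst_mult_le)
    have "total_degree (Q ^ i) \<le> 2 * m" if "i \<in> {1..m}" for i
      using total_degree_power_le[OF Q, of i] that by simp
    then have f1: "total_degree f1 \<le> 2 * m"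
      unfolding assms(4) using \<open>total_degree bX \<le> 2 * m\<close>
      by (intro total_degree_add_le total_degree_sum_le total_degree_bconst_mult_le)
    then have f2: "total_degree f2 \<le> 2 * m"
      unfolding assms(5) using Q assms(1)
      by (intro total_degree_add_le total_degree_bconst_mult_le) auto
    have "coeff (coeff f1 0) (2 * m) \<noteq> 0"
      using coeff_on_x_axis_shear[OF assms(3,4)] assms(1,2) that by simp
    then show ?thesis
      using system_degree_half_norm[OF assms(6) f1 f2] assms(1) by simp
  qed
  moreover have "[4 * m - 1 = 3] (mod 4)"
    using assms(1) by (cases m) (simp_all add: cong_def)
  ultimately show ?thesis
    using jac by auto
qed

end
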